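(* Let $A=[a_{ij}]\in\mathbb{R}^{n\times n}$ be the coefficient matrix of a fuzzy linear system $A\tilde X=\tilde Y$, let $S=\begin{bmatrix} D & E\\ E & D\end{bmatrix}\in\mathbb{R}^{2n\times 2n}$ be its associated matrix, where $D=[\max(a_{ij},0)]$ and $E=[\max(-a_{ij},0)]$, and let $k=\mathrm{ind}(S)$. Let $SX(r)=Y(r)$, $r\in[0,1]$, be the associated crisp linear system, with right-hand side $Y:[0,1]\to\mathbb{R}^{2n}$. Then $X=S^{\dagger_{c}}Y$, where $S^{\dagger_{c}}$ is the core-EP inverse of $S$, is a solution of the crisp linear system (that is, $S\,S^{\dagger_{c}}Y(r)=Y(r)$ for all $r\in[0,1]$) if and only if $Y\in\mathcal{R}(S^{k})$ (that is, $Y(r)\in\mathcal{R}(S^{k})$ for all $r\in[0,1]$).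
   Context: For a real matrix $M$, $M^{*}$ denotes its transpose and $\mathcal{R}(M)$ its column space. For a real square matrix $M$, $\mathrm{ind}(M)$ is the smallest nonnegative integer $k$ with $\operatorname{rank}(M^{k+1})=\operatorname{rank}(M^{k})$ (with $M^0=I$). For a real square matrix $M$ with $\mathrm{ind}(M)=k$, the core-EP inverse of $M$, denoted here $M^{\dagger_{c}}$, is the unique real matrix $X$ of the same size satisfying $XM^{k+1}=M^{k}$, $MX^{2}=X$ and $(MX)^{*}=MX$; it exists for every square matrix. A fuzzy number is an ordered pair of functions $\tilde z(r)=(\underline z(r),\overline z(r))$, $r\in[0,1]$, such that $\underline z$ is bounded, left continuous and nondecreasing on $[0,1]$, $\overline z$ is bounded, left continuous and nonincreasing on $[0,1]$, and $\underline z(r)\le\overline z(r)$ for all $r$. A fuzzy linear system is a system $A\tilde X=\tilde Y$ with $A$ a real $n\times n$ matrix, $\tilde X=(\tilde x_1,\dots,\tilde x_n)^T$ an unknown vector of fuzzy numbers and $\tilde Y=(\tilde y_1,\dots,\tilde y_n)^T$ a given vector of fuzzy numbers. Its associated crisp linear system is $SX(r)=Y(r)$, $r\in[0,1]$, with $$X(r)=(\underline x_1(r),\dots,\underline x_n(r),-\overline x_1(r),\dots,-\overline x_n(r))^T,\qquad Y(r)=(\underline y_1(r),\dots,\underline y_n(r),-\overline y_1(r),\dots,-\overline y_n(r))^T.$$ A solution of the crisp linear system is any function $X:[0,1]\to\mathbb{R}^{2n}$ satisfying $SX(r)=Y(r)$ for all $r\in[0,1]$ (it need not come from a vector of fuzzy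 numbers). *)

theory Defs
  imports "HOL-Analysis.Analysis"
begin

text \<open>The library product on vectors is componentwise, so powers with respect to
  the matrix product are introduced explicitly.\<close>

primrec mat_power :: "real^'n^'n \<Rightarrow> nat \<Rightarrow> real^'n^'n" where
  "mat_power M 0 = mat 1"
| "mat_power M (Suc k) = M ** mat_power M k"

definition mat_index :: "real^'n^'n \<Rightarrow> nat" where
  "mat_index M = (LEAST k. rank (mat_power M (k + 1)) = rank (mat_power M k))"

definition column_space :: "real^'n^'m \<Rightarrow> (real^'m) set" where
  "column_space M = span (columns M)"

definition is_core_EP_inverse :: "real^'n^'n \<Rightarrow> real^'n^'n \<Rightarrow> bool" where
  "is_core_EP_inverse M X \<longleftrightarrow>
     X ** mat_power M (mat_index M + 1) = mat_power M (mat_index M) \<and>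
     M ** (X ** X) = X \<and>
     transpose (M ** X) = M ** X"

definition core_EP_inverse :: "real^'n^'n \<Rightarrow> real^'n^'n" where
  "core_EP_inverse M = (THE X. is_core_EP_inverse M X)"

text \<open>A fuzzy number is a pair of a lower and an upper branch; only their values on
  \<open>{0..1}\<close> matter. Left continuity is void at \<open>0\<close>.\<close>

type_synonym branches = "(real \<Rightarrow> real) \<times> (real \<Rightarrow> real)"

definition left_continuous_unit :: "(real \<Rightarrow> real) \<Rightarrow> bool" where
  "left_continuous_unit f \<longleftrightarrow> (\<forall>r\<in>{0<..1}. continuous (at_left r) f)"

definition fuzzy_number :: "branches \<Rightarrow> bool" where
  "fuzzy_number z \<longleftrightarrow>
     bounded (fst z ` {0..1}) \<and> left_continuous_unit (fst z) \<and> mono_on {0..1} (fst z) \<and>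
     bounded (snd z ` {0..1}) \<and> left_continuous_unit (snd z) \<and> antimono_on {0..1} (snd z) \<and>
     (\<forall>r\<in>{0..1}. fst z r \<le> snd z r)"

text \<open>Coordinates \<open>1, \<dots>, 2n\<close> are indexed by the sum type \<open>'n + 'n\<close>:
  \<open>Inl\<close> is the first and \<open>Inr\<close> the second block of \<open>n\<close> coordinates.\<close>

definition pos_part :: "real^'n^'m \<Rightarrow> real^'n^'m" where
  "pos_part A = (\<chi> i j. max (A $ i $ j) 0)"

definition neg_part :: "real^'n^'m \<Rightarrow> real^'n^'m" where
  "neg_part A = (\<chi> i j. max (- (A $ i $ j)) 0)"

definition block_matrix ::
  "real^'n^'n \<Rightarrow> real^'n^'n \<Rightarrow> real^'n^'n \<Rightarrow> real^'n^'n \<Rightarrow> real^('n + 'n)^('n + 'n)" where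
  "block_matrix P Q R T = (\<chi> i j.
     case (i, j) of
       (Inl a, Inl b) \<Rightarrow> P $ a $ b
     | (Inl a, Inr b) \<Rightarrow> Q $ a $ b
     | (Inr a, Inl b) \<Rightarrow> R $ a $ b
     | (Inr a, Inr b) \<Rightarrow> T $ a $ b)"

definition associated_matrix :: "real^'n^'n \<Rightarrow> real^('n + 'n)^('n + 'n)" where
  "associated_matrix A = block_matrix (pos_part A) (neg_part A) (neg_part A) (pos_part A)"

definition crisp_vector :: "branches^'n \<Rightarrow> real \<Rightarrow> real^('n + 'n)" where
  "crisp_vector z r = (\<chi> i. case i of
       Inl a \<Rightarrow> fst (z $ a) r
     | Inr a \<Rightarrow> - snd (z $ a) r)"

text \<open>A solution is an arbitrary function on \<open>{0..1}\<close>; it is not required to come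
  from a vector of fuzzy numbers.\<close>

definition crisp_solution ::
  "real^'m^'m \<Rightarrow> (real \<Rightarrow> real^'m) \<Rightarrow> (real \<Rightarrow> real^'m) \<Rightarrow> bool" where
  "crisp_solution S Y X \<longleftrightarrow> (\<forall>r\<in>{0..1}. S *v X r = Y r)"

end

theory Submission
  imports Defs
begin

text \<open>
  Write \<open>W\<close> for the range of \<open>M\<^sup>k\<close>, \<open>k = ind M\<close>. The product \<open>M X\<close> of \<open>M\<close> with its core-EP
  inverse \<open>X\<close> is the orthogonal projection onto \<open>W\<close>: it fixes \<open>M\<^sup>k\<close>, and \<open>X = M\<^sup>k X\<^sup>k\<^sup>+\<^sup>1\<close>. Hence
  \<open>M X y = y\<close> exactly if \<open>y\<close> lies in \<open>W\<close>. Conversely, stabilisation of the rank makes \<open>M\<close> a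
  bijection of \<open>W\<close>, and the inverse of this bijection composed with the orthogonal projection
  onto \<open>W\<close> is a core-EP inverse.
\<close>

section \<open>Column spaces, ranks and factorisations\<close>

lemma column_space_eq_range: "column_space M = range ((*v) M)"
proof
  have "subspace (range ((*v) M))"
    by (intro linear_subspace_image matrix_vector_mul_linear subspace_UNIV)
  moreover have "columns M \<subseteq> range ((*v) M)"
    by (auto simp: columns_image_basis)
  ultimately show "column_space M \<subseteq> range ((*v) M)"
    unfolding column_space_def by (rule span_minimal[rotated])
qed (auto simp: column_space_def matrix_vector_mult_in_columnspace)

lemma column_space_mult_subset:
  fixes A :: "real^'n^'m" and B :: "real^'p^'n"
  shows "column_space (A ** B) \<subseteq> column_space A"
  by (auto simp: column_space_eq_range simp flip: matrix_vector_mul_assoc)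

text \<open>Each column of \<open>B\<close> has a preimage under \<open>A\<close>; these preimages
  are the columns of \<open>C\<close>.\<close>

lemma matrix_factor_if_columns_in_column_space:
  fixes A :: "real^'n^'m" and B :: "real^'p^'m"
  assumes "\<And>x. B *v x \<in> column_space A"
  obtains C where "B = A ** C"
proof -
  have "\<forall>j. \<exists>x. B *v axis j 1 = A *v x"
    using assms by (auto simp: column_space_eq_range image_iff)
  then obtain f where f: "\<And>j. B *v axis j 1 = A *v f j"
    by metis
  have "column j B = column j (A ** (\<chi> a b. f b $ a))" for j
  proof -
    have "(A ** (\<chi> a b. f b $ a)) *v axis j 1 = A *v ((\<chi> a b. f b $ a) *v axis j 1)"
      by (simp add: matrix_vector_mul_assoc)
    also have "(\<chi> a b. f b $ a) *v axis j 1 = f j"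
      by (simp add: matrix_vector_mult_basis column_def)
    finally show ?thesis
      using f[of j] by (simp add: matrix_vector_mult_basis)
  qed
  then have "B = A ** (\<chi> a b. f b $ a)"
    by (simp add: vec_eq_iff column_def)
  then show ?thesis ..
qed

text \<open>Nested subspaces of equal finite dimension coincide.\<close>

lemma column_space_mult_eq_if_rank_eq:
  fixes A :: "real^'n^'m" and B :: "real^'p^'n"
  assumes "rank (A ** B) = rank A"
  shows "column_space (A ** B) = column_space A"
  using column_space_mult_subset[of A B] assms
  by (intro subspace_dim_equal) (auto simp: column_space_def column_rank_def)

lemma right_factor_if_rank_mult_eq:
  fixes A :: "real^'n^'m" and B :: "real^'p^'n"
  assumes "rank (A ** B) = rank A"
  obtains C where "A = A ** B ** C"
proof (rule matrix_factor_if_columns_in_column_space)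
  show "A *v x \<in> column_space (A ** B)" for x
    using column_space_mult_eq_if_rank_eq[OF assms] by (simp add: column_space_eq_range)
qed

text \<open>Dual to the right factor: rank is invariant under transposition, which swaps the
  sides.\<close>

lemma left_factor_if_rank_mult_eq:
  fixes A :: "real^'n^'m" and B :: "real^'p^'n"
  assumes "rank (A ** B) = rank B"
  obtains C where "B = C ** (A ** B)"
proof -
  have "rank (transpose B ** transpose A) = rank (transpose B)"
    using assms by (simp add: rank_transpose flip: matrix_transpose_mul)
  then obtain C where "transpose B = transpose B ** transpose A ** C"
    by (rule right_factor_if_rank_mult_eq)
  then have "B = transpose (transpose B ** transpose A ** C)"
    by (metis transpose_transpose)
  also have "\<dots> = transpose C ** (A ** B)"
    by (simp add: matrix_transpose_mul matrix_mul_assoc)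
  finally show ?thesis ..
qed

section \<open>Matrix powers and the index\<close>

lemma mat_power_commute: "mat_power M k ** M = M ** mat_power M k"
  by (induction k) (simp_all flip: matrix_mul_assoc)

lemma rank_mat_power_index:
  "rank (mat_power M (Suc (mat_index M))) = rank (mat_power M (mat_index M))"
proof -
  \<comment> \<open>A power of minimal rank witnesses that the set under \<open>LEAST\<close> is
    nonempty: the next power cannot have smaller rank.\<close>
  obtain k where k: "rank (mat_power M k) \<le> rank (mat_power M j)" for j
    using ex_has_least_nat[of "\<lambda>_. True" 0 "\<lambda>k. rank (mat_power M k)"] by auto
  have "rank (mat_power M (Suc k)) \<le> rank (mat_power M k)"
    by (simp add: rank_mul_le_right)
  with k[of "Suc k"] have "rank (mat_power M (k + 1)) = rank (mat_power M k)"
    by simp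
  then show ?thesis
    unfolding mat_index_def by (rule LeastI2) simp
qed

lemma orthogonal_projection_matrix_exists:
  fixes W :: "(real^'n) set"
  assumes "subspace W"
  obtains P :: "real^'n^'n"
  where "transpose P = P" "\<And>x. P *v x \<in> W" "\<And>w. w \<in> W \<Longrightarrow> P *v w = w"
proof -
  obtain B where B: "B \<subseteq> W" "pairwise orthogonal B" "\<And>b. b \<in> B \<Longrightarrow> norm b = 1"
    "independent B" "span B = W"
    by (rule orthonormal_basis_subspace[OF assms]) (rule that)
  have "finite B"
    using B(4) by (rule independent_imp_finite)
  \<comment> \<open>The sum of the rank-one projections \<open>b b^T\<close> over an orthonormal
    basis of \<open>W\<close>.\<close>
  define P :: "real^'n^'n" where "P = (\<chi> i j. \<Sum>b\<in>B. b $ i * b $ j)"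
  have P: "P *v x = (\<Sum>b\<in>B. (b \<bullet> x) *\<^sub>R b)" for x
  proof -
    have "(P *v x) $ i = (\<Sum>b\<in>B. (b \<bullet> x) *\<^sub>R b) $ i" for i
    proof -
      have "(P *v x) $ i = (\<Sum>j\<in>UNIV. \<Sum>b\<in>B. b $ i * b $ j * x $ j)"
        by (simp add: P_def matrix_vector_mult_def sum_distrib_right)
      also have "\<dots> = (\<Sum>b\<in>B. \<Sum>j\<in>UNIV. b $ i * b $ j * x $ j)"
        by (rule sum.swap)
      also have "\<dots> = (\<Sum>b\<in>B. (b \<bullet> x) *\<^sub>R b) $ i"
        by (simp add: inner_vec_def sum_distrib_left mult_ac)
      finally show ?thesis .
    qed
    then show ?thesis
      by (simp add: vec_eq_iff)
  qed
  show ?thesis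
  proof
    show "transpose P = P"
      by (simp add: P_def transpose_def mult.commute)
    show "P *v x \<in> W" for x
      unfolding P using B(1) assms by (auto intro!: subspace_sum subspace_scale)
    show "P *v w = w" if "w \<in> W" for w
    proof (rule linear_eq_on_span[where f = "(*v) P" and g = "\<lambda>w. w" and B = B])
      fix c assume c: "c \<in> B"
      have "P *v c = (\<Sum>b\<in>B. if b = c then c else 0)"
        unfolding P using B(2) B(3)[OF c] c
        by (intro sum.cong)
          (auto simp: pairwise_def orthogonal_def dot_square_norm)
      then show "P *v c = c"
        using \<open>finite B\<close> c by simp
    qed (use that B(5) in \<open>auto intro: linear_id[unfolded id_def]\<close>)
  qed
qed

section \<open>Uniqueness and existence of the core-EP inverse\<close>

lemma core_EP_inverse_mult_power:
  assumes "is_core_EP_inverse M X"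
  shows "M ** X ** mat_power M (mat_index M) = mat_power M (mat_index M)"
proof -
  let ?k = "mat_index M"
  have X: "X ** mat_power M (Suc ?k) = mat_power M ?k" "M ** (X ** X) = X"
    using assms by (auto simp: is_core_EP_inverse_def)
  \<comment> \<open>Replace the last factor by \<open>X ** mat_power M (Suc ?k)\<close>, so that
    \<open>M ** (X ** X)\<close> appears and collapses to \<open>X\<close>.\<close>
  have "M ** X ** mat_power M ?k = M ** (X ** X) ** mat_power M (Suc ?k)"
    by (metis X(1) matrix_mul_assoc)
  then show ?thesis
    by (simp only: X)
qed

text \<open>Iterating \<open>X = M ** X ** X\<close> pulls arbitrarily many factors \<open>M\<close>
  out to the left.\<close>

lemma core_EP_inverse_eq_power_mult:
  assumes "is_core_EP_inverse M X"
  shows "\<exists>Z. X = mat_power M j ** Z"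
proof (induction j)
  case 0
  show ?case by (auto intro: exI[of _ X])
next
  case (Suc j)
  then obtain Z where Z: "X = mat_power M j ** Z" ..
  have "X = M ** X ** X"
    using assms by (simp add: is_core_EP_inverse_def matrix_mul_assoc)
  also have "\<dots> = mat_power M (Suc j) ** (Z ** X)"
    by (subst (1) Z) (simp add: matrix_mul_assoc)
  finally show ?case ..
qed

text \<open>\<open>X\<close> undoes \<open>M\<close> on the range of
  \<open>mat_power M (mat_index M)\<close>, which contains the columns of \<open>X'\<close>.\<close>

lemma core_EP_inverse_mult_self_mult:
  assumes X: "is_core_EP_inverse M X" and X': "is_core_EP_inverse M X'"
  shows "X ** (M ** X') = X'"
proof -
  obtain Z where Z: "X' = mat_power M (mat_index M) ** Z"
    using core_EP_inverse_eq_power_mult[OF X'] by blast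
  have "X ** (M ** X') = X ** mat_power M (Suc (mat_index M)) ** Z"
    by (simp add: Z matrix_mul_assoc)
  also have "\<dots> = X'"
    using X by (simp add: is_core_EP_inverse_def Z)
  finally show ?thesis .
qed

lemma is_core_EP_inverse_unique:
  assumes X: "is_core_EP_inverse M X" and X': "is_core_EP_inverse M X'"
  shows "X = X'"
proof -
  have absorb: "M ** U ** (M ** V) = M ** V"
    if "is_core_EP_inverse M U" "is_core_EP_inverse M V" for U V
    using core_EP_inverse_mult_self_mult[OF that] by (metis matrix_mul_assoc)
  have sym: "transpose (M ** X) = M ** X" "transpose (M ** X') = M ** X'"
    using assms by (auto simp: is_core_EP_inverse_def)
  \<comment> \<open>Both products are symmetric, so transposing reverses their order and both
    absorption laws apply.\<close>
  have "M ** X = transpose (M ** X' ** (M ** X))"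
    using absorb[OF X' X] sym by simp
  also have "\<dots> = M ** X ** (M ** X')"
    by (simp only: matrix_transpose_mul[of "M ** X'"] sym)
  also have "\<dots> = M ** X'"
    using absorb[OF X X'] .
  finally have "X ** (M ** X) = X ** (M ** X')"
    by (rule arg_cong)
  then show ?thesis
    by (simp only: core_EP_inverse_mult_self_mult[OF X X] core_EP_inverse_mult_self_mult[OF X X'])
qed

lemma is_core_EP_inverse_exists: "\<exists>X. is_core_EP_inverse M X"
proof -
  define N where "N = mat_power M (mat_index M)"
  have comm: "N ** M = M ** N"
    by (simp add: N_def mat_power_commute)
  have rank: "rank (M ** N) = rank N"
    using rank_mat_power_index[of M] by (simp add: N_def)
  obtain P where P: "transpose P = P" "\<And>x. P *v x \<in> column_space N"
    "\<And>w. w \<in> column_space N \<Longrightarrow> P *v w = w"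
    using orthogonal_projection_matrix_exists[of "column_space N"]
    by (auto simp: column_space_def)
  have PN: "P ** N = N"
    using P(3) by (auto simp: matrix_eq column_space_eq_range simp flip: matrix_vector_mul_assoc)
  \<comment> \<open>Because \<open>N\<close> and \<open>M\<close> commute, the rank equality also
    says that multiplying \<open>N\<close> by \<open>M\<close> on the right keeps its range.\<close>
  have "column_space (M ** N) = column_space N"
    using column_space_mult_eq_if_rank_eq[of N M] rank comm by simp
  then obtain C where C: "P = M ** N ** C"
    using matrix_factor_if_columns_in_column_space[of P "M ** N"] P(2) by auto
  obtain L where L: "N = L ** (M ** N)"
    using left_factor_if_rank_mult_eq[OF rank] .
  \<comment> \<open>Chosen so that \<open>M ** X\<close> is the projection \<open>P\<close> while
    the columns of \<open>X\<close> stay in the range of \<open>N\<close>.\<close>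
  define X where "X = N ** C"
  have MX: "M ** X = P"
    by (simp add: X_def C matrix_mul_assoc)
  have "M ** (X ** X) = X"
    by (simp add: matrix_mul_assoc MX) (simp add: X_def matrix_mul_assoc PN)
  moreover have "transpose (M ** X) = M ** X"
    by (simp add: MX P(1))
  moreover have "X ** (M ** N) = N"
  proof -
    \<comment> \<open>\<open>L\<close> inverts \<open>M\<close> on the range of \<open>N\<close>.\<close>
    have "X ** (M ** N) = L ** (M ** N) ** (C ** (M ** N))"
      by (simp add: X_def flip: L matrix_mul_assoc)
    \<comment> \<open>Regrouping exposes \<open>M ** N ** C = P\<close>; commuting \<open>M\<close>
      past \<open>N\<close> then lets \<open>N\<close> absorb \<open>P\<close>.\<close>
    also have "\<dots> = L ** (P ** N ** M)"
      by (simp add: C comm flip: matrix_mul_assoc)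
    also have "\<dots> = N"
      by (simp add: PN comm flip: L)
    finally show ?thesis .
  qed
  ultimately have "is_core_EP_inverse M X"
    by (simp add: is_core_EP_inverse_def N_def)
  then show ?thesis ..
qed

lemma core_EP_inverse: "is_core_EP_inverse M (core_EP_inverse M)"
proof -
  obtain X where X: "is_core_EP_inverse M X"
    using is_core_EP_inverse_exists ..
  show ?thesis
    unfolding core_EP_inverse_def
    using X by (rule theI[of "is_core_EP_inverse M"]) (rule is_core_EP_inverse_unique[OF _ X])
qed

section \<open>The solvability criterion\<close>

lemma mult_core_EP_inverse_eq_iff:
  "M *v (core_EP_inverse M *v v) = v \<longleftrightarrow> v \<in> column_space (mat_power M (mat_index M))"
proof
  let ?N = "mat_power M (mat_index M)"
  assume v: "M *v (core_EP_inverse M *v v) = v"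
  obtain Z where "core_EP_inverse M = ?N ** Z"
    using core_EP_inverse_eq_power_mult[OF core_EP_inverse] by blast
  \<comment> \<open>Commuting \<open>M\<close> past \<open>?N\<close> puts \<open>?N\<close>
    leftmost, so every value of the product lies in its range.\<close>
  then have "M ** core_EP_inverse M = ?N ** (M ** Z)"
    by (simp add: mat_power_commute matrix_mul_assoc)
  then have "v = ?N *v (M ** Z *v v)"
    using v by (simp add: matrix_vector_mul_assoc)
  then show "v \<in> column_space ?N"
    unfolding column_space_eq_range by blast
next
  assume "v \<in> column_space (mat_power M (mat_index M))"
  then obtain u where "v = mat_power M (mat_index M) *v u"
    by (auto simp: column_space_eq_range)
  then show "M *v (core_EP_inverse M *v v) = v"
    using core_EP_inverse_mult_power[OF core_EP_inverse, of M]
    by (simp add: matrix_vector_mul_assoc matrix_mul_assoc)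
qed

theorem theorem4p1:
  fixes A :: "real^'n^'n"
    and y :: "branches^'n"
    and S :: "real^('n + 'n)^('n + 'n)"
    and Y :: "real \<Rightarrow> real^('n + 'n)"
    and k :: nat
  assumes "\<forall>i. fuzzy_number (y $ i)"
    and "S = associated_matrix A"
    and "k = mat_index S"
    and "Y = crisp_vector y"
  shows "crisp_solution S Y (\<lambda>r. core_EP_inverse S *v Y r)
    \<longleftrightarrow> (\<forall>r\<in>{0..1}. Y r \<in> column_space (mat_power S k))"
  \<comment> \<open>The criterion is applied at each \<open>r\<close> separately, with
    \<open>v = Y r\<close>.\<close>
  by (simp add: crisp_solution_def mult_core_EP_inverse_eq_iff assms(3))

end
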